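(* Let $\Omega^z_0$ be the set of all $(x,z,\theta)$ with $x\in Q$, $z\in\{0,1\}^{p\times p}$, $\theta\in\mathbb{R}^p$ satisfying (b) $\sum_{i\in P}z_{ij}=1$ for all $j\in P$; (c) $\sum_{j\in P}z_{ij}=1$ for all $i\in P$; (d$^0$) $C^i x\le \theta_j+M(1-z_{ij})$ for all $i,j\in P$; (e) $\theta_j\ge\theta_{j+1}$ for all $j\in P$, $j<p$. Let $\Omega^z$ be the set obtained from the same definition by replacing (d$^0$) by (d) $C^i x\le \theta_j+M\bigl(1-\sum_{k\ge j}z_{ik}\bigr)$ for all $i,j\in P$. Then $\Omega^z_0=\Omega^z$.
   Context: $P=\{1,\dots,p\}$. $Q\subseteq\mathbb{R}^n$ is the feasible set of a combinatorial optimization problem (a combinatorial object representable by a system of linear inequalities). $C\in\mathbb{R}^{p\times n}$ is a matrix whose rows $C^i$, $i\in P$, are the cost vectors of $p$ objective (cost) functions $x\mapsto C^i x$. $M$ is a non-negative upper bound on the value of all the cost functions, i.e. $M\ge 0$ and $C^i x\le M$ for all $x\in Q$, $i\in P$. *)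

theory Defs
  imports "Jordan_Normal_Form.Matrix"
begin

text \<open>
  Indices are shifted by one, as matrices and vectors of the library are indexed from 0: the index
  set \<open>{1, \<dots>, p}\<close> becomes \<open>{..<p}\<close>, so \<open>i < p\<close> below means \<open>i \<in> P\<close>, and the sum over \<open>k \<ge> j\<close>
  runs over \<open>{j..<p}\<close>. The value of the \<open>i\<close>-th cost function at \<open>x\<close> is \<open>row C i \<bullet> x\<close>.
\<close>

definition Omega_z0 ::
  "nat \<Rightarrow> real vec set \<Rightarrow> real mat \<Rightarrow> real \<Rightarrow> (real vec \<times> real mat \<times> real vec) set"
where
  "Omega_z0 p Q C M = {(x, z, \<theta>).
     x \<in> Q \<and>
     z \<in> carrier_mat p p \<and> (\<forall>i<p. \<forall>j<p. z $$ (i, j) \<in> {0, 1}) \<and>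
     \<theta> \<in> carrier_vec p \<and>
     (\<forall>j<p. (\<Sum>i<p. z $$ (i, j)) = 1) \<and>
     (\<forall>i<p. (\<Sum>j<p. z $$ (i, j)) = 1) \<and>
     (\<forall>i<p. \<forall>j<p. row C i \<bullet> x \<le> \<theta> $ j + M * (1 - z $$ (i, j))) \<and>
     (\<forall>j. Suc j < p \<longrightarrow> \<theta> $ j \<ge> \<theta> $ Suc j)}"

definition Omega_z ::
  "nat \<Rightarrow> real vec set \<Rightarrow> real mat \<Rightarrow> real \<Rightarrow> (real vec \<times> real mat \<times> real vec) set"
where
  "Omega_z p Q C M = {(x, z, \<theta>).
     x \<in> Q \<and>
     z \<in> carrier_mat p p \<and> (\<forall>i<p. \<forall>j<p. z $$ (i, j) \<in> {0, 1}) \<and>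
     \<theta> \<in> carrier_vec p \<and>
     (\<forall>j<p. (\<Sum>i<p. z $$ (i, j)) = 1) \<and>
     (\<forall>i<p. (\<Sum>j<p. z $$ (i, j)) = 1) \<and>
     (\<forall>i<p. \<forall>j<p. row C i \<bullet> x \<le> \<theta> $ j + M * (1 - (\<Sum>k\<in>{j..<p}. z $$ (i, k)))) \<and>
     (\<forall>j. Suc j < p \<longrightarrow> \<theta> $ j \<ge> \<theta> $ Suc j)}"

end

theory Submission
  imports Defs
begin

text \<open>
  Constraint (d) is stronger than (d\<open>\<^sup>0\<close>) because \<open>M \<ge> 0\<close> and the partial sum of a row of \<open>z\<close>
  dominates each of its terms. Conversely, if the partial sum from \<open>j\<close> on vanishes, then (d) is
  (d\<open>\<^sup>0\<close>) at \<open>j\<close>; otherwise it equals 1, the unique 1 of the row sits at some \<open>k \<ge> j\<close>, and (d\<open>\<^sup>0\<close>)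
  at \<open>k\<close> together with \<open>\<theta> $ k \<le> \<theta> $ j\<close> gives (d).
\<close>

lemma antimono_below:
  fixes t :: "nat \<Rightarrow> 'a::order"
  assumes step: "\<And>j. Suc j < p \<Longrightarrow> t (Suc j) \<le> t j"
    and "j \<le> k" "k < p"
  shows "t k \<le> t j"
  using assms(2,3)
proof (induction k rule: dec_induct)
  case base
  then show ?case by simp
next
  case (step k)
  then show ?case using assms(1)[of k] by (auto intro: order_trans)
qed

text \<open>Rows of \<open>z\<close> do not interact in either constraint family, so one row
  suffices: \<open>f\<close> is row \<open>i\<close> of \<open>z\<close>, \<open>c\<close> the
  \<open>i\<close>-th cost at \<open>x\<close>, \<open>t\<close> the entries of
  \<open>\<theta>\<close>.\<close>

lemma big_M_tail_sum_iff:
  fixes f t :: "nat \<Rightarrow> real" and c M :: real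
  assumes bin: "\<And>k. k < p \<Longrightarrow> f k \<in> {0, 1}"
    and one: "(\<Sum>k<p. f k) = 1"
    and anti: "\<And>j. Suc j < p \<Longrightarrow> t (Suc j) \<le> t j"
    and "M \<ge> 0"
  shows "(\<forall>j<p. c \<le> t j + M * (1 - f j)) \<longleftrightarrow> (\<forall>j<p. c \<le> t j + M * (1 - (\<Sum>k\<in>{j..<p}. f k)))"
    (is "?single \<longleftrightarrow> ?tail")
proof
  have nonneg: "0 \<le> f k" if "k < p" for k
    using bin[OF that] by auto
  have le_tail: "f k \<le> (\<Sum>k\<in>{j..<p}. f k)" if "j \<le> k" "k < p" for j k
    using that nonneg by (intro member_le_sum) auto
  { assume single: ?single
    show ?tail
    proof (intro allI impI)
      fix j assume j: "j < p"
      show "c \<le> t j + M * (1 - (\<Sum>k\<in>{j..<p}. f k))"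
      proof (cases "\<exists>k\<in>{j..<p}. f k = 1")
        case True
        then obtain k where k: "j \<le> k" "k < p" "f k = 1" by auto
        \<comment> \<open>The tail is squeezed between \<open>f k = 1\<close> and the full row sum
          1, so the big-M term vanishes.\<close>
        have "(\<Sum>k\<in>{j..<p}. f k) \<le> (\<Sum>k<p. f k)"
          using nonneg by (intro sum_mono2) auto
        with one le_tail[OF k(1,2)] k(3) have "(\<Sum>k\<in>{j..<p}. f k) = 1" by simp
        moreover have "t k \<le> t j"
          using anti k(1,2) by (rule antimono_below)
        moreover have "c \<le> t k" using single k by auto
        ultimately show ?thesis by simp
      next
        case False
        then have zero: "f k = 0" if "k \<in> {j..<p}" for k
          using bin[of k] that by auto
        \<comment> \<open>Both sides are 0, since \<open>j\<close> itself lies in the tail.\<close>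
        then have "(\<Sum>k\<in>{j..<p}. f k) = f j" using j by simp
        with single j show ?thesis by simp
      qed
    qed }
  { assume tail: ?tail
    show ?single
    proof (intro allI impI)
      fix j assume j: "j < p"
      \<comment> \<open>The sign of \<open>M\<close> matters here: a larger sum leaves less
        slack.\<close>
      have "M * (1 - (\<Sum>k\<in>{j..<p}. f k)) \<le> M * (1 - f j)"
        using le_tail[of j j] j \<open>M \<ge> 0\<close> by (intro mult_left_mono) auto
      with tail j show "c \<le> t j + M * (1 - f j)" by force
    qed }
qed

theorem mainTheorem1:
  fixes p n :: nat and Q :: "real vec set" and C :: "real mat" and M :: real
  assumes "Q \<subseteq> carrier_vec n"
    and "C \<in> carrier_mat p n"
    and "M \<ge> 0"
    and "\<forall>x\<in>Q. \<forall>i<p. row C i \<bullet> x \<le> M"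
  shows "Omega_z0 p Q C M = Omega_z p Q C M"
proof -
  \<comment> \<open>The premises are constraints common to both sets, so the equivalence may be used
    under them.\<close>
  have d0_iff_d: "(\<forall>i<p. \<forall>j<p. row C i \<bullet> x \<le> \<theta> $ j + M * (1 - z $$ (i, j))) \<longleftrightarrow>
      (\<forall>i<p. \<forall>j<p. row C i \<bullet> x \<le> \<theta> $ j + M * (1 - (\<Sum>k\<in>{j..<p}. z $$ (i, k))))"
    if "\<forall>i<p. \<forall>j<p. z $$ (i, j) \<in> {0, 1}" "\<forall>i<p. (\<Sum>j<p. z $$ (i, j)) = 1"
      "\<forall>j. Suc j < p \<longrightarrow> \<theta> $ j \<ge> \<theta> $ Suc j" for x z \<theta>
    using that \<open>M \<ge> 0\<close>
    by (intro all_cong big_M_tail_sum_iff) auto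
  have "(x, z, \<theta>) \<in> Omega_z0 p Q C M \<longleftrightarrow> (x, z, \<theta>) \<in> Omega_z p Q C M" for x z \<theta>
    unfolding Omega_z0_def Omega_z_def mem_Collect_eq prod.case
    using d0_iff_d[of z \<theta> x] by argo
  then show ?thesis by (simp add: set_eq_iff split_paired_all)
qed

end
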